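(* The principle $\Diamond(\mathbb{N}^{\mathbb{N}}, =^\infty)$ implies $\mathfrak{a}_g = \aleph_1$.
   Context: For $f,g\in\mathbb{N}^{\mathbb{N}}$, $f =^\infty g$ means $\{n : f(n)=g(n)\}$ is infinite. A function $F : {}^{<\omega_1}2 \to \mathbb{N}^{\mathbb{N}}$ is Borel if for every $\delta<\omega_1$ its restriction to ${}^\delta 2$ is a Borel function. $\Diamond(\mathbb{N}^{\mathbb{N}},=^\infty)$ is the statement: for every Borel $F : {}^{<\omega_1}2\to\mathbb{N}^{\mathbb{N}}$ there is $G:\omega_1\to\mathbb{N}^{\mathbb{N}}$ such that for every $f:\omega_1\to 2$ the set $\{\delta<\omega_1 : F(f\upharpoonright\delta) =^\infty G(\delta)\}$ is stationary. A subgroup of $\mathrm{Sym}(\mathbb{N})$ (the bijections of $\mathbb{N}$) is cofinitary if each non-identity element has finitely many fixed points, and maximal cofinitary if it is cofinitary and not properly contained in another cofinitary subgroup. $\mathfrak{a}_g$ is the least cardinality of a maximal cofinitary group. *)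

theory Defs
  imports "HOL-Analysis.Analysis" "HOL-Algebra.Bij" "HOL-Library.Equipollence"
begin

definition inf_eq :: "(nat \<Rightarrow> nat) \<Rightarrow> (nat \<Rightarrow> nat) \<Rightarrow> bool" where
  "inf_eq f g \<longleftrightarrow> infinite {n. f n = g n}"

definition is_omega1_type :: "'w::wellorder itself \<Rightarrow> bool" where
  "is_omega1_type _ \<longleftrightarrow> uncountable (UNIV :: 'w set) \<and> (\<forall>a::'w. countable {x. x < a})"

definition club :: "'w::wellorder set \<Rightarrow> bool" where
  "club C \<longleftrightarrow> (\<forall>b. \<exists>c\<in>C. b < c) \<and>
     (\<forall>a. ((\<exists>c\<in>C. c < a) \<and> (\<forall>b<a. \<exists>c\<in>C. b < c \<and> c < a)) \<longrightarrow> a \<in> C)"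

definition stationary :: "'w::wellorder set \<Rightarrow> bool" where
  "stationary S \<longleftrightarrow> (\<forall>C. club C \<longrightarrow> S \<inter> C \<noteq> {})"

definition cantor_top :: "'w::wellorder \<Rightarrow> ('w \<Rightarrow> bool) topology" where
  "cantor_top d = product_topology (\<lambda>_. (euclidean :: bool topology)) {x. x < d}"

definition borel_of_top :: "'a topology \<Rightarrow> 'a measure" where
  "borel_of_top X = sigma (topspace X) {U. openin X U}"

text \<open>F : ^{<\<omega>1}2 \<rightarrow> N^N, encoded as F \<delta> s for s \<in> ^\<delta>2; Borel means each restriction
  F \<delta> is Borel measurable from ^\<delta>2 to Baire space.\<close>
definition borel_F :: "('w::wellorder \<Rightarrow> ('w \<Rightarrow> bool) \<Rightarrow> (nat \<Rightarrow> nat)) \<Rightarrow> bool" where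
  "borel_F F \<longleftrightarrow> (\<forall>d. F d \<in> measurable (borel_of_top (cantor_top d)) borel)"

definition diamond_NN :: "'w::wellorder itself \<Rightarrow> bool" where
  "diamond_NN _ \<longleftrightarrow> (\<forall>F :: 'w \<Rightarrow> ('w \<Rightarrow> bool) \<Rightarrow> (nat \<Rightarrow> nat). borel_F F \<longrightarrow>
     (\<exists>G :: 'w \<Rightarrow> (nat \<Rightarrow> nat). \<forall>f :: 'w \<Rightarrow> bool.
        stationary {d. inf_eq (F d (restrict f {x. x < d})) (G d)}))"

definition cofinitary_group :: "(nat \<Rightarrow> nat) set \<Rightarrow> bool" where
  "cofinitary_group G \<longleftrightarrow> subgroup G (BijGroup (UNIV :: nat set)) \<and>
     (\<forall>g\<in>G. g \<noteq> id \<longrightarrow> finite {n. g n = n})"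

definition max_cofinitary_group :: "(nat \<Rightarrow> nat) set \<Rightarrow> bool" where
  "max_cofinitary_group G \<longleftrightarrow> cofinitary_group G \<and>
     \<not> (\<exists>H. cofinitary_group H \<and> G \<subset> H)"

definition ag_equals :: "'a set \<Rightarrow> bool" where
  "ag_equals A \<longleftrightarrow> (\<exists>G. max_cofinitary_group G \<and> G \<approx> A) \<and>
     (\<forall>G. max_cofinitary_group G \<longrightarrow> A \<lesssim> G)"

end

theory Submission
  imports Defs
begin

text \<open>Generators \<open>g\<^sub>\<delta>\<close> (\<open>\<delta> < \<omega>\<^sub>1\<close>) are built by recursion. Given the countable cofinitary group
  \<open>G\<^sub>\<delta>\<close> generated so far, \<open>g\<^sub>\<delta>\<close> is the union of finite partial injections, each obtained from the
  previous one by adding a pair one of whose ends is \<^emph>\<open>fresh\<close>: no element of a finite subset of \<open>G\<^sub>\<delta>\<close>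
  (growing with the stage) sends it to a point already in use, and none but the identity fixes it. If
  \<open>z\<close> is a fixed point of a cyclically reduced word in \<open>g\<^sub>\<delta>\<close>, the closed path that computes the word at
  \<open>z\<close> cannot use a fresh end of its most recently added pair; so all its pairs are old, and there are
  only finitely many such \<open>z\<close>.

  If \<open>h\<close> lies outside \<open>G\<^sub>\<delta>\<close> and generates a cofinitary group with it, then for all but finitely many \<open>k\<close>
  the pair \<open>(k, h k)\<close> may be added, and a finite piece of the graph of \<open>h\<close> that is certain to contain
  such a pair depends only on \<open>h\<close>, the stage, and finitely many of the earlier generators. Hence some
  \<open>f : \<omega>\<^sub>1 \<rightarrow> 2\<close> codes all these pieces such that for club many \<open>\<delta>\<close> the restriction of \<open>f\<close> to \<open>\<delta>\<close> lists
  those relevant at \<open>\<delta>\<close>, which makes the function \<open>F\<close> given to the diamond principle trivially Borel.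
  A guess that is right infinitely often lets \<open>g\<^sub>\<delta>\<close> agree with \<open>h\<close> infinitely often, so \<open>h\<close> cannot be
  added to the group generated by all \<open>g\<^sub>\<delta>\<close>.\<close>

section \<open>Permutation groups as plain sets of functions\<close>

abbreviation pinv :: "('a \<Rightarrow> 'a) \<Rightarrow> 'a \<Rightarrow> 'a" where
  "pinv f \<equiv> inv_into UNIV f"

definition cof :: "('a \<Rightarrow> 'a) \<Rightarrow> bool" where
  "cof u \<longleftrightarrow> u = id \<or> finite {n. u n = n}"

definition perm_group :: "('a \<Rightarrow> 'a) set \<Rightarrow> bool" where
  "perm_group G \<longleftrightarrow> (\<forall>g\<in>G. bij g) \<and> id \<in> G \<and> (\<forall>g\<in>G. \<forall>h\<in>G. g \<circ> h \<in> G) \<and> (\<forall>g\<in>G. pinv g \<in> G)"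

lemma perm_groupD:
  assumes "perm_group G"
  shows "g \<in> G \<Longrightarrow> bij g" "id \<in> G" "g \<in> G \<Longrightarrow> h \<in> G \<Longrightarrow> g \<circ> h \<in> G" "g \<in> G \<Longrightarrow> pinv g \<in> G"
  using assms by (auto simp: perm_group_def)

lemma pinv_apply [simp]: "bij g \<Longrightarrow> pinv g (g x) = x" "bij g \<Longrightarrow> g (pinv g x) = x"
  by (simp_all add: bij_is_inj bij_is_surj surj_f_inv_f)

lemma pinv_comp [simp]: "bij g \<Longrightarrow> pinv g \<circ> g = id" "bij g \<Longrightarrow> g \<circ> pinv g = id"
  by (simp_all add: fun_eq_iff)

lemma carrier_BijGroup_UNIV: "carrier (BijGroup UNIV) = {g. bij g}"
  by (auto simp: BijGroup_def Bij_def)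

lemma mult_BijGroup_UNIV: "bij g \<Longrightarrow> bij h \<Longrightarrow> g \<otimes>\<^bsub>BijGroup UNIV\<^esub> h = g \<circ> h"
  by (simp add: BijGroup_def Bij_def compose_def comp_def fun_eq_iff)

lemma one_BijGroup_UNIV: "\<one>\<^bsub>BijGroup UNIV\<^esub> = id"
  by (simp add: BijGroup_def fun_eq_iff)

lemma inv_BijGroup_UNIV:
  assumes "bij g"
  shows "inv\<^bsub>BijGroup UNIV\<^esub> g = pinv g"
proof (rule group.inv_equality[OF group_BijGroup])
  show "pinv g \<otimes>\<^bsub>BijGroup UNIV\<^esub> g = \<one>\<^bsub>BijGroup UNIV\<^esub>"
    using assms by (simp add: mult_BijGroup_UNIV one_BijGroup_UNIV bij_imp_bij_inv)
qed (use assms in \<open>simp_all add: carrier_BijGroup_UNIV bij_imp_bij_inv\<close>)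

lemma subgroup_BijGroup_iff: "subgroup G (BijGroup UNIV) \<longleftrightarrow> perm_group G"
proof
  assume S: "subgroup G (BijGroup UNIV)"
  have b: "bij g" if "g \<in> G" for g
    using subgroup.subset[OF S] that by (auto simp: carrier_BijGroup_UNIV)
  show "perm_group G"
    unfolding perm_group_def
    using b subgroup.one_closed[OF S] subgroup.m_closed[OF S] subgroup.m_inv_closed[OF S]
    by (metis inv_BijGroup_UNIV mult_BijGroup_UNIV one_BijGroup_UNIV)
next
  assume G: "perm_group G"
  show "subgroup G (BijGroup UNIV)"
    by (rule subgroup.intro)
       (use G in \<open>auto simp: perm_group_def carrier_BijGroup_UNIV mult_BijGroup_UNIV
          one_BijGroup_UNIV inv_BijGroup_UNIV\<close>)
qed

lemma cofinitary_group_iff: "cofinitary_group G \<longleftrightarrow> perm_group G \<and> (\<forall>g\<in>G. cof g)"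
  by (auto simp: cofinitary_group_def subgroup_BijGroup_iff cof_def)

text \<open>Conjugating by \<open>v\<close> carries the fixed points of \<open>u \<circ> v\<close>
  to those of \<open>v \<circ> u\<close>. This is the tool for rotating words cyclically.\<close>

lemma cof_comp_commute:
  fixes u v :: "'a \<Rightarrow> 'a"
  assumes "cof (u \<circ> v)" "bij u" "bij v"
  shows "cof (v \<circ> u)"
proof (cases "u \<circ> v = id")
  case True
  then have "u (v (u x)) = u x" for x
    by (simp add: fun_eq_iff)
  then have "v \<circ> u = id"
    using bij_is_inj[OF assms(2)] by (simp add: fun_eq_iff inj_eq)
  then show ?thesis by (simp add: cof_def)
next
  case False
  then have "finite {n. (u \<circ> v) n = n}" using assms(1) by (simp add: cof_def)
  moreover have "{n. (v \<circ> u) n = n} \<subseteq> v ` {n. (u \<circ> v) n = n}"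
  proof
    fix n assume "n \<in> {n. (v \<circ> u) n = n}"
    then have "v (u n) = n" by simp
    then show "n \<in> v ` {n. (u \<circ> v) n = n}"
      by (intro image_eqI[of _ _ "u n"]) auto
  qed
  ultimately show ?thesis
    by (auto simp: cof_def intro: finite_surj)
qed

subsection \<open>Words over a permutation group with one new letter\<close>

text \<open>A list of pairs \<open>(\<gamma>, b)\<close> stands for the word \<open>\<gamma>\<^sub>1 x\<^sup>\<plusminus>\<^sup>1 \<gamma>\<^sub>2 x\<^sup>\<plusminus>\<^sup>1 \<dots>\<close>; it is evaluated at \<open>x = r\<close>.\<close>

definition spow :: "('a \<Rightarrow> 'a) \<Rightarrow> bool \<Rightarrow> 'a \<Rightarrow> 'a" where
  "spow r b = (if b then r else pinv r)"

fun word_eval :: "('a \<Rightarrow> 'a) \<Rightarrow> (('a \<Rightarrow> 'a) \<times> bool) list \<Rightarrow> 'a \<Rightarrow> 'a" where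
  "word_eval r [] = id"
| "word_eval r ((\<gamma>, b) # ws) = \<gamma> \<circ> spow r b \<circ> word_eval r ws"

lemma word_eval_append: "word_eval r (us @ vs) = word_eval r us \<circ> word_eval r vs"
  by (induction us rule: word_eval.induct[of "\<lambda>_ us. _ us" r]) (auto simp: comp_assoc)

lemma bij_spow: "bij r \<Longrightarrow> bij (spow r b)"
  by (simp add: spow_def bij_imp_bij_inv)

lemma spow_opposite: "bij r \<Longrightarrow> spow r b \<circ> spow r (\<not> b) = id"
  by (cases b) (simp_all add: spow_def)

lemma bij_word_eval:
  "bij r \<Longrightarrow> (\<forall>(\<gamma>, b)\<in>set ws. bij \<gamma>) \<Longrightarrow> bij (word_eval r ws)"
proof (induction ws)
  case (Cons a ws)
  then show ?case
    by (cases a) (auto simp del: o_apply intro!: bij_comp bij_spow simp flip: comp_assoc)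
qed simp

definition letter :: "'a list \<Rightarrow> nat \<Rightarrow> 'a" where
  "letter ws i = ws ! (i mod length ws)"

text \<open>Between the exponents of letters \<open>i\<close> and \<open>Suc i\<close> stands the
  coefficient of letter \<open>Suc i\<close>; if it is \<open>id\<close>, opposite exponents would
  cancel. The last and first letters count as neighbours, so a one-letter word is always cyclically
  reduced.\<close>

definition cyc_reduced :: "(('a \<Rightarrow> 'a) \<times> bool) list \<Rightarrow> bool" where
  "cyc_reduced ws \<longleftrightarrow>
     (\<forall>i. fst (letter ws (Suc i)) = id \<longrightarrow> snd (letter ws i) = snd (letter ws (Suc i)))"

lemma cof_word_eval_rotate:
  assumes "bij r" "\<forall>(\<gamma>, b)\<in>set ws. bij \<gamma>" "cof (word_eval r (rotate n ws))"
  shows "cof (word_eval r ws)"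
proof -
  define m where "m = n mod length ws"
  have "rotate n ws = drop m ws @ take m ws"
    by (simp add: rotate_drop_take m_def)
  then have "cof (word_eval r (drop m ws) \<circ> word_eval r (take m ws))"
    using assms(3) by (simp add: word_eval_append)
  then have "cof (word_eval r (take m ws) \<circ> word_eval r (drop m ws))"
    by (rule cof_comp_commute)
       (use assms in \<open>auto intro!: bij_word_eval dest: in_set_takeD in_set_dropD\<close>)
  then show ?thesis
    by (simp add: word_eval_append[symmetric])
qed

text \<open>Induction on the length: the trailing coefficient is conjugated to the front, and a
  cancelling pair is rotated to the two ends of the word and conjugated away. What remains ends in a
  coefficient, hence the \<open>\<gamma>0\<close> in the statement.\<close>

lemma cof_words_if_cof_reduced_words:
  assumes r: "bij r" and G: "perm_group G" and cofG: "\<forall>\<gamma>\<in>G. cof \<gamma>"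
    and red: "\<And>ws. ws \<noteq> [] \<Longrightarrow> cyc_reduced ws \<Longrightarrow> fst ` set ws \<subseteq> G \<Longrightarrow> cof (word_eval r ws)"
    and "fst ` set ws \<subseteq> G" "\<gamma>0 \<in> G"
  shows "cof (word_eval r ws \<circ> \<gamma>0)"
  using assms(5,6)
proof (induction "length ws" arbitrary: ws \<gamma>0 rule: less_induct)
  case less
  note Gb = perm_groupD[OF G]
  have bijW: "bij (word_eval r us)" if "fst ` set us \<subseteq> G" for us
    by (rule bij_word_eval) (use r that Gb(1) in auto)
  show ?case
  proof (cases ws)
    case Nil
    then show ?thesis using less.prems cofG by simp
  next
    case (Cons a vs)
    obtain \<gamma> b where a: "a = (\<gamma>, b)" by force
    define us where "us = (\<gamma>0 \<circ> \<gamma>, b) # vs"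
    have usG: "fst ` set us \<subseteq> G"
      using less.prems Cons a Gb(3) by (auto simp: us_def)
    have usW: "word_eval r us = \<gamma>0 \<circ> word_eval r ws"
      by (simp add: us_def Cons a comp_assoc)
    have ne: "us \<noteq> []" by (simp add: us_def)
    have len: "length us = length ws" by (simp add: us_def Cons)
    have "cof (word_eval r us)"
    proof (cases "cyc_reduced us")
      case True
      then show ?thesis using red usG ne by blast
    next
      case False
      then obtain i where i: "fst (letter us (Suc i)) = id" "snd (letter us i) \<noteq> snd (letter us (Suc i))"
        by (auto simp: cyc_reduced_def)
      \<comment> \<open>Now the letter with coefficient \<open>id\<close> comes first and the one
        with the opposite exponent last.\<close>
      define xs where "xs = rotate (Suc i) us"
      have l0: "xs ! 0 = letter us (Suc i)"
        using ne nth_rotate[of 0 us "Suc i"] by (simp add: xs_def letter_def del: rotate_Suc)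
      have lxs: "length xs = length us" by (simp add: xs_def)
      have lpos: "length us > 0" using ne by simp
      have lm: "xs ! (length us - 1) = letter us i"
      proof -
        have "xs ! (length us - 1) = us ! ((Suc i + (length us - 1)) mod length us)"
          unfolding xs_def using lpos by (subst nth_rotate) auto
        also have "Suc i + (length us - 1) = i + length us" using lpos by simp
        finally show ?thesis by (simp add: letter_def)
      qed
      have "length us \<noteq> 1"
      proof
        assume "length us = 1"
        then have "letter us i = letter us (Suc i)" by (simp add: letter_def)
        with i(2) show False by simp
      qed
      with lpos lxs have "length xs \<ge> 2" by linarith
      then obtain p ys q where xs: "xs = p # ys @ [q]"
        by (metis (no_types, lifting) One_nat_def Suc_1 Suc_le_length_iff append_butlast_last_id list.distinct(1))
      obtain b' where p: "p = (id, b')"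
        using l0 i(1) xs by (metis nth_Cons_0 prod.collapse)
      have "q = letter us i"
        using lm xs lxs by (simp add: nth_append flip: lxs)
      moreover have "p = letter us (Suc i)"
        using l0 xs by simp
      ultimately have "snd q \<noteq> b'"
        using i(2) p by (metis snd_conv)
      then obtain \<gamma>' where q: "q = (\<gamma>', \<not> b')"
        by (cases q) auto
      have setxs: "set xs = set us" by (simp add: xs_def)
      have ysG: "fst ` set ys \<subseteq> G" and g': "\<gamma>' \<in> G"
        using usG unfolding setxs[symmetric] xs q by auto
      have "length ys < length ws"
        using lxs len xs by simp
      then have "cof (word_eval r ys \<circ> \<gamma>')"
        using less.hyps ysG g' by blast
      \<comment> \<open>Appending two cancelling powers of \<open>r\<close> and moving the last one
        to the front rebuilds \<open>xs\<close> from the shorter word.\<close>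
      then have "cof ((word_eval r ys \<circ> \<gamma>' \<circ> spow r (\<not> b')) \<circ> spow r b')"
        using spow_opposite[OF r, of "\<not> b'"] by (simp add: comp_assoc)
      then have "cof (spow r b' \<circ> (word_eval r ys \<circ> \<gamma>' \<circ> spow r (\<not> b')))"
        by (rule cof_comp_commute) (use bijW[OF ysG] Gb(1)[OF g'] r in \<open>auto intro!: bij_comp bij_spow\<close>)
      then have "cof (word_eval r xs)"
        by (simp add: xs p q word_eval_append comp_assoc)
      then show ?thesis
        unfolding xs_def by (rule cof_word_eval_rotate[OF r, rotated]) (use usG Gb(1) in auto)
    qed
    then have "cof (\<gamma>0 \<circ> word_eval r ws)" by (simp add: usW)
    then show ?thesis
      by (rule cof_comp_commute) (use bijW less.prems Gb(1) in auto)
  qed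
qed

subsection \<open>Extending finite partial injections\<close>

definition fresh :: "('a \<Rightarrow> 'a) set \<Rightarrow> 'a set \<Rightarrow> 'a \<Rightarrow> bool" where
  "fresh E D c \<longleftrightarrow> (\<forall>\<gamma>\<in>E. \<gamma> c \<notin> D \<and> (\<gamma> c = c \<longrightarrow> \<gamma> = id))"

text \<open>A closed path through a finite partial injection cannot use a pair with a fresh second
  coordinate: there is nowhere to go from that coordinate except back along the same pair.\<close>

lemma closed_path_avoids_fresh_pair:
  fixes y t :: "nat \<Rightarrow> 'a" and \<gamma> :: "nat \<Rightarrow> 'a \<Rightarrow> 'a" and b :: "nat \<Rightarrow> bool"
  assumes edges: "\<And>i. (if b i then (y (Suc i), t i) else (t i, y (Suc i))) \<in> insert (k, l) q"
    and y: "\<And>i. y i = \<gamma> i (t i)"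
    and red: "\<And>i. \<gamma> (Suc i) = id \<Longrightarrow> b i = b (Suc i)"
    and \<gamma>: "\<And>i. \<gamma> i \<in> E" "\<And>i. pinv (\<gamma> i) \<in> E" "\<And>i. bij (\<gamma> i)"
    and fresh: "fresh E (Domain q \<union> Range q \<union> {k}) l"
  shows "(if b (Suc i) then (y (Suc (Suc i)), t (Suc i)) else (t (Suc i), y (Suc (Suc i)))) \<noteq> (k, l)"
proof
  assume e: "(if b (Suc i) then (y (Suc (Suc i)), t (Suc i)) else (t (Suc i), y (Suc (Suc i)))) = (k, l)"
  have fr: "g l \<notin> Domain q \<union> Range q \<union> {k}" "g l = l \<Longrightarrow> g = id" if "g \<in> E" for g
    using fresh that by (auto simp: fresh_def)
  show False
  proof (cases "b (Suc i)")
    case True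
    \<comment> \<open>The path runs through falling indices, from \<open>y (Suc i)\<close> via
      \<open>t i\<close> to \<open>y i\<close>. Here it reaches \<open>l\<close> and continues from
      \<open>\<gamma> (Suc i) l\<close>, an end of edge \<open>i\<close>; freshness leaves only a
      turn back at \<open>l\<close>.\<close>
    with e have "t (Suc i) = l" by simp
    then have yi: "y (Suc i) = \<gamma> (Suc i) l" using y by simp
    show False
    proof (cases "b i")
      case True
      then have "y (Suc i) \<in> Domain q \<union> {k}" using edges[of i] by auto
      with yi fr(1)[OF \<gamma>(1)[of "Suc i"]] show False by auto
    next
      case False
      then have "y (Suc i) \<in> Range q \<union> {l}" using edges[of i] by auto
      with yi fr(1)[OF \<gamma>(1)[of "Suc i"]] have "\<gamma> (Suc i) l = l" by auto
      then have "\<gamma> (Suc i) = id" using fr(2) \<gamma>(1) by blast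
      with red False \<open>b (Suc i)\<close> show False by blast
    qed
  next
    case False
    \<comment> \<open>Here the path leaves \<open>l\<close>; the argument is applied in reverse,
      with the inverse coefficient, to the preceding edge \<open>Suc (Suc i)\<close>.\<close>
    with e have "y (Suc (Suc i)) = l" by simp
    then have "l = \<gamma> (Suc (Suc i)) (t (Suc (Suc i)))" using y by simp
    then have t: "pinv (\<gamma> (Suc (Suc i))) l = t (Suc (Suc i))"
      using \<gamma>(3) by simp
    show False
    proof (cases "b (Suc (Suc i))")
      case True
      then have "t (Suc (Suc i)) \<in> Range q \<union> {l}" using edges[of "Suc (Suc i)"] by auto
      with t fr(1)[OF \<gamma>(2)[of "Suc (Suc i)"]] have *: "pinv (\<gamma> (Suc (Suc i))) l = l" by auto
      then have "pinv (\<gamma> (Suc (Suc i))) = id" using fr(2) \<gamma>(2) by blast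
      then have "\<gamma> (Suc (Suc i)) = id"
        using pinv_comp(1)[OF \<gamma>(3)[of "Suc (Suc i)"]] by simp
      with red False True show False by blast
    next
      case False
      then have "t (Suc (Suc i)) \<in> Domain q \<union> {k}" using edges[of "Suc (Suc i)"] by auto
      with t fr(1)[OF \<gamma>(2)[of "Suc (Suc i)"]] show False by auto
    qed
  qed
qed

definition addable :: "('a \<Rightarrow> 'a) set \<Rightarrow> ('a \<times> 'a) set \<Rightarrow> 'a \<Rightarrow> 'a \<Rightarrow> bool" where
  "addable E q k l \<longleftrightarrow> k \<notin> Domain q \<and> l \<notin> Range q \<and>
     (fresh E (Domain q \<union> Range q \<union> {k}) l \<or> fresh E (Domain q \<union> Range q \<union> {l}) k)"

lemma finite_subset_mono_UN:
  fixes E :: "nat \<Rightarrow> 'a set"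
  assumes "finite A" "mono E" "A \<subseteq> (\<Union>j. E j)"
  shows "\<exists>N. A \<subseteq> E N"
  using assms(1,3)
proof (induction A)
  case (insert a A)
  then obtain N M where "A \<subseteq> E N" "a \<in> E M" by auto
  moreover have "E N \<subseteq> E (max N M)" "E M \<subseteq> E (max N M)"
    using assms(2) by (auto simp: mono_def)
  ultimately have "insert a A \<subseteq> E (max N M)" by blast
  then show ?case ..
qed simp

text \<open>Let \<open>E N\<close> contain all coefficients. A fixed point outside the field of
  \<open>q N\<close> would yield a closed path using a pair added after stage \<open>N\<close>; the
  latest such pair has an end that is fresh for all coefficients, which
  \<open>closed_path_avoids_fresh_pair\<close> forbids.\<close>

lemma cof_reduced_word_of_chain:
  fixes q :: "nat \<Rightarrow> ('a \<times> 'a) set" and E :: "nat \<Rightarrow> ('a \<Rightarrow> 'a) set"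
  assumes r: "bij r" and graph: "\<And>n. \<exists>j. (n, r n) \<in> q j"
    and fin: "\<And>j. finite (q j)"
    and step: "\<And>j. q (Suc j) = q j \<or> (\<exists>k l. q (Suc j) = insert (k, l) (q j) \<and> addable (E j) (q j) k l)"
    and monoE: "mono E" and symE: "\<And>j \<gamma>. \<gamma> \<in> E j \<Longrightarrow> bij \<gamma> \<and> pinv \<gamma> \<in> E j"
    and ws: "ws \<noteq> []" "cyc_reduced ws" "fst ` set ws \<subseteq> (\<Union>j. E j)"
  shows "finite {z. word_eval r ws z = z}"
proof -
  have "q j \<subseteq> q (Suc j)" for j
    using step[of j] by blast
  then have monoq: "i \<le> j \<Longrightarrow> q i \<subseteq> q j" for i j
    by (rule lift_Suc_mono_le)
  define m where "m = length ws"
  have m: "m > 0" using ws(1) by (simp add: m_def)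
  define \<gamma> where "\<gamma> i = fst (letter ws i)" for i
  define b where "b i = snd (letter ws i)" for i
  have letter_in: "letter ws i \<in> set ws" for i
    using m by (simp add: letter_def m_def)
  have "\<exists>N. fst ` set ws \<subseteq> E N"
    using finite_subset_mono_UN[OF _ monoE ws(3)] by simp
  then obtain N where N: "fst ` set ws \<subseteq> E N" ..
  have red: "\<gamma> (Suc i) = id \<Longrightarrow> b i = b (Suc i)" for i
    using ws(2) by (simp add: cyc_reduced_def \<gamma>_def b_def)
  have "z \<in> Domain (q N) \<union> Range (q N)" if z: "word_eval r ws z = z" for z
  proof (rule ccontr)
    assume zN: "z \<notin> Domain (q N) \<union> Range (q N)"
    \<comment> \<open>The value at \<open>z\<close> of the suffix starting at position
      \<open>i\<close>; as \<open>z\<close> is fixed, wrapping round at \<open>m\<close> closes the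
      path.\<close>
    define y where "y i = word_eval r (drop (i mod m) ws) z" for i
    define t where "t i = spow r (b i) (y (Suc i))" for i
    have per: "y (i + m) = y i" "b (i + m) = b i" "\<gamma> (i + m) = \<gamma> i" for i
      by (simp_all add: y_def b_def \<gamma>_def letter_def m_def)
    have yt: "y i = \<gamma> i (t i)" for i
    proof -
      have lt: "i mod m < m" using m by simp
      then have "drop (i mod m) ws = letter ws i # drop (Suc (i mod m)) ws"
        by (simp add: letter_def m_def Cons_nth_drop_Suc)
      moreover have "letter ws i = (\<gamma> i, b i)" by (simp add: \<gamma>_def b_def)
      moreover have "word_eval r (drop (Suc (i mod m)) ws) z = y (Suc i)"
      proof (cases "Suc (i mod m) = m")
        case True
        then have "Suc i mod m = 0" by (simp add: mod_Suc)
        with True z show ?thesis by (simp add: y_def m_def)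
      next
        case False
        then show ?thesis by (simp add: y_def mod_Suc)
      qed
      ultimately show ?thesis by (simp add: y_def t_def)
    qed
    define e where "e i = (if b i then (y (Suc i), t i) else (t i, y (Suc i)))" for i
    have e_per: "e (i + m) = e i" for i
      using per(1)[of "Suc i"] per(2)[of i] by (simp add: e_def t_def)
    have "\<exists>j. e i \<in> q j" for i
    proof (cases "b i")
      case True
      then show ?thesis using graph[of "y (Suc i)"] by (simp add: e_def t_def spow_def)
    next
      case False
      then show ?thesis using graph[of "pinv r (y (Suc i))"] r by (simp add: e_def t_def spow_def)
    qed
    then obtain J where J: "\<And>i. e i \<in> q (J i)" by metis
    define M where "M = Max (J ` {..<m})"
    have e_mod: "e i = e (i mod m)" for i
    proof -
      have "y (Suc i) = y (Suc (i mod m))" by (simp add: y_def mod_Suc_eq)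
      moreover have "b i = b (i mod m)" by (simp add: b_def letter_def m_def)
      ultimately show ?thesis by (simp add: e_def t_def)
    qed
    have "\<forall>i. e i \<in> q M"
    proof
      fix i
      have "J (i mod m) \<le> M" using m by (auto simp: M_def)
      then show "e i \<in> q M" using J[of "i mod m"] monoq e_mod[of i] by auto
    qed
    \<comment> \<open>The first stage containing the whole path. It exceeds \<open>N\<close> because
      edge \<open>m - 1\<close>, the first one traversed, has \<open>z\<close> as an end.\<close>
    define j1 where "j1 = (LEAST j. \<forall>i. e i \<in> q j)"
    have j1: "\<forall>i. e i \<in> q j1"
      unfolding j1_def by (rule LeastI[of _ M]) fact
    have "e (m - 1) \<notin> q N"
    proof -
      have "y (Suc (m - 1)) = z" using m z by (simp add: y_def)
      then show ?thesis using zN by (auto simp: e_def split: if_splits)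
    qed
    then have "N < j1" using j1 monoq[of j1 N] by (meson not_le subsetD)
    then obtain j where j: "j1 = Suc j" "N \<le> j" by (cases j1) auto
    have "\<not> (\<forall>i. e i \<in> q j)"
      using not_less_Least[of j "\<lambda>j. \<forall>i. e i \<in> q j"] j by (simp add: j1_def)
    then obtain i0 where i0: "e i0 \<notin> q j" by blast
    with j1 j obtain k l where kl: "q (Suc j) = insert (k, l) (q j)" "addable (E j) (q j) k l"
      using step[of j] by metis
    have ekl: "e i \<in> insert (k, l) (q j)" for i using j1 j kl by simp
    have \<gamma>E: "\<gamma> i \<in> E j" for i
      using N letter_in[of i] monoD[OF monoE j(2)] by (auto simp: \<gamma>_def)
    then have \<gamma>B: "bij (\<gamma> i)" and \<gamma>I: "pinv (\<gamma> i) \<in> E j" for i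
      using symE by blast+
    \<comment> \<open>Shifting by a period gives the edge an index of the form \<open>Suc i\<close>,
      with neighbours on both sides.\<close>
    obtain i where i: "i0 + m = Suc i" using m by (cases "i0 + m") auto
    have ei: "e (Suc i) = (k, l)"
      using i e_per[of i0] i0 ekl[of i0] by auto
    from kl(2) consider "fresh (E j) (Domain (q j) \<union> Range (q j) \<union> {k}) l"
      | "fresh (E j) (Domain (q j) \<union> Range (q j) \<union> {l}) k"
      by (auto simp: addable_def)
    then show False
    proof cases
      case 1
      show False
        using closed_path_avoids_fresh_pair[where b = b and y = y and t = t and \<gamma> = \<gamma> and E = "E j", of k l "q j" i]
          1 ekl yt red \<gamma>E \<gamma>B \<gamma>I ei by (auto simp: e_def)
    next
      case 2
      \<comment> \<open>When the first coordinate is fresh, passing to the converse relation and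
        flipping all exponents exchanges the coordinates.\<close>
      have "(if \<not> b i then (y (Suc i), t i) else (t i, y (Suc i))) \<in> insert (l, k) ((q j)\<inverse>)" for i
        using ekl[of i] by (auto simp: e_def)
      then show False
        using closed_path_avoids_fresh_pair[where b = "\<lambda>i. \<not> b i" and y = y and t = t and \<gamma> = \<gamma> and E = "E j", of l k "(q j)\<inverse>" i]
          2 yt red \<gamma>E \<gamma>B \<gamma>I ei by (auto simp: e_def Un_commute split: if_splits)
    qed
  qed
  then have "{z. word_eval r ws z = z} \<subseteq> Domain (q N) \<union> Range (q N)" by blast
  then show ?thesis
    using fin[of N] by (auto intro: finite_subset simp: finite_Domain finite_Range)
qed

lemma finite_preimage_inj:
  "inj g \<Longrightarrow> finite D \<Longrightarrow> finite {x. g x \<in> D}"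
  using finite_vimageI[of D g] by (simp add: vimage_def)

lemma finite_not_fresh:
  assumes "finite E" "finite D" "\<And>\<gamma>. \<gamma> \<in> E \<Longrightarrow> bij \<gamma> \<and> cof \<gamma>"
  shows "finite {c. \<not> fresh E D c}"
proof -
  have "{c. \<not> fresh E D c} \<subseteq> (\<Union>\<gamma>\<in>E. {c. \<gamma> c \<in> D} \<union> (if \<gamma> = id then {} else {c. \<gamma> c = c}))"
    by (auto simp: fresh_def)
  moreover have "finite (\<Union>\<gamma>\<in>E. {c. \<gamma> c \<in> D} \<union> (if \<gamma> = id then {} else {c. \<gamma> c = c}))"
    using assms by (auto simp: cof_def bij_is_inj intro!: finite_preimage_inj)
  ultimately show ?thesis by (rule finite_subset)
qed

lemma addable_domain:
  fixes q :: "('a \<times> 'a) set"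
  assumes "infinite (UNIV :: 'a set)" "finite q" "finite E" "\<And>\<gamma>. \<gamma> \<in> E \<Longrightarrow> bij \<gamma> \<and> cof \<gamma>" "k \<notin> Domain q"
  shows "\<exists>l. addable E q k l"
proof -
  have "finite ({c. \<not> fresh E (Domain q \<union> Range q \<union> {k}) c} \<union> Range q)"
    using assms by (intro finite_UnI finite_not_fresh) (auto simp: finite_Domain finite_Range)
  from ex_new_if_finite[OF assms(1) this] show ?thesis
    using assms(5) by (auto simp: addable_def)
qed

lemma addable_converse: "addable E (q\<inverse>) k l \<longleftrightarrow> addable E q l k"
  by (auto simp: addable_def Un_commute)

lemma addable_range:
  fixes q :: "('a \<times> 'a) set"
  assumes "infinite (UNIV :: 'a set)" "finite q" "finite E" "\<And>\<gamma>. \<gamma> \<in> E \<Longrightarrow> bij \<gamma> \<and> cof \<gamma>" "l \<notin> Range q"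
  shows "\<exists>k. addable E q k l"
  using addable_domain[of "q\<inverse>" E l] assms by (simp add: addable_converse)

text \<open>Whether a finite piece \<open>A\<close> of the graph of \<open>h\<close> is a good guess for stage \<open>n\<close> depends only on
  \<open>E\<close>, \<open>n\<close> and \<open>h\<close>, and not on the partial injection built so far, about which only the size
  bound \<open>n\<close> is used. This is what makes the guess codable below \<open>\<delta>\<close>.\<close>

definition good_guess :: "('a \<Rightarrow> 'a) set \<Rightarrow> nat \<Rightarrow> ('a \<Rightarrow> 'a) \<Rightarrow> ('a \<times> 'a) set \<Rightarrow> bool" where
  "good_guess E n h A \<longleftrightarrow> finite A \<and> (\<forall>(k, l)\<in>A. l = h k) \<and>
     (\<forall>q. finite q \<longrightarrow> card q \<le> n \<longrightarrow> (\<exists>(k, l)\<in>A. addable E q k l))"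

text \<open>The finite set \<open>B\<close> holds the points that are bad whatever \<open>q\<close>
  is. Outside \<open>B\<close>, a relation with at most \<open>n\<close> pairs blocks at most
  \<open>b\<close> points, by injectivity, so one set of \<open>b + 1\<close> points serves every
  such \<open>q\<close>.\<close>

lemma ex_good_guess:
  fixes h :: "'a \<Rightarrow> 'a"
  assumes inf: "infinite (UNIV :: 'a set)" and h: "bij h" and E: "finite E"
    and \<gamma>: "\<And>\<gamma>. \<gamma> \<in> E \<Longrightarrow> bij \<gamma> \<and> cof \<gamma> \<and> finite {x. (\<gamma> \<circ> h) x = x}"
  shows "\<exists>A. good_guess E n h A"
proof -
  define B where "B = (\<Union>\<gamma>\<in>E. {k. \<gamma> (h k) = k} \<union> (if \<gamma> = id then {} else {k. \<gamma> (h k) = h k}))"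
  have "finite {k. \<gamma> (h k) = h k}" if "\<gamma> \<in> E" "\<gamma> \<noteq> id" for \<gamma>
    using finite_preimage_inj[OF bij_is_inj[OF h], of "{x. \<gamma> x = x}"] \<gamma>[OF that(1)] that(2)
    by (simp add: cof_def)
  then have "finite B"
    using E \<gamma> by (auto simp: B_def)
  \<comment> \<open>The summands count the points in \<open>Domain q\<close>, those with
    \<open>h k\<close> in \<open>Range q\<close>, and those that some
    \<open>\<gamma> \<circ> h\<close> sends to one of the at most \<open>n + n\<close> points used
    by \<open>q\<close>.\<close>
  define b where "b = n + n + card E * (n + n)"
  obtain S where S: "finite S" "card S = Suc b" "S \<subseteq> - B"
    using infinite_arbitrarily_large[of "- B" "Suc b"] \<open>finite B\<close> inf by (metis finite_Un Compl_partition)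
  have "\<exists>k\<in>S. addable E q k (h k)" if q: "finite q" "card q \<le> n" for q
  proof -
    define F where "F = Domain q \<union> Range q"
    have cD: "card (Domain q) \<le> n" and cR: "card (Range q) \<le> n"
      using q card_image_le[of q fst] card_image_le[of q snd] by (auto simp: Domain_fst Range_snd)
    have fF: "finite (Domain q)" "finite (Range q)"
      using q by (simp_all add: finite_Domain finite_Range)
    have pre: "finite {k. g k \<in> D} \<and> card {k. g k \<in> D} \<le> card D" if "bij g" "finite D" for g :: "'a \<Rightarrow> 'a" and D
      using that card_vimage_inj[of g D] by (simp add: bij_is_inj bij_is_surj finite_preimage_inj vimage_def)
    have cF: "card F \<le> n + n"
      unfolding F_def using card_Un_le[of "Domain q" "Range q"] cD cR by simp
    have "card (\<Union>\<gamma>\<in>E. {k. \<gamma> (h k) \<in> F}) \<le> (\<Sum>\<gamma>\<in>E. card {k. \<gamma> (h k) \<in> F})"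
      using E by (rule card_UN_le)
    also have "\<dots> \<le> card E * (n + n)"
    proof (rule sum_bounded_above[of E _ "n + n", simplified])
      fix g assume "g \<in> E"
      then have "card {k. (g \<circ> h) k \<in> F} \<le> card F"
        using pre[of "g \<circ> h" F] \<gamma> h fF by (simp add: F_def bij_comp del: o_apply)
      then show "card {k. g (h k) \<in> F} \<le> n + n" using cF by simp
    qed
    finally have c3: "card (\<Union>\<gamma>\<in>E. {k. \<gamma> (h k) \<in> F}) \<le> card E * (n + n)" .
    define X where "X = Domain q \<union> {k. h k \<in> Range q} \<union> (\<Union>\<gamma>\<in>E. {k. \<gamma> (h k) \<in> F})"
    have "card {k. h k \<in> Range q} \<le> n"
      using pre[OF h fF(2)] cR by simp
    then have "card X \<le> b"
      unfolding X_def b_def using card_Un_le[of "Domain q \<union> {k. h k \<in> Range q}" "\<Union>\<gamma>\<in>E. {k. \<gamma> (h k) \<in> F}"]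
        card_Un_le[of "Domain q" "{k. h k \<in> Range q}"] c3 cD by linarith
    moreover have "finite X"
    proof -
      have "finite {k. (g \<circ> h) k \<in> F}" if "g \<in> E" for g
        using pre[of "g \<circ> h" F] \<gamma>[OF that] h fF by (simp add: F_def bij_comp del: o_apply)
      then show ?thesis using E fF pre[OF h fF(2)] by (simp add: X_def)
    qed
    ultimately have "\<not> S \<subseteq> X" using S(2) card_mono[of X S] by auto
    then obtain k where k: "k \<in> S" "k \<notin> X" by blast
    then have "k \<notin> B" using S by auto
    have "fresh E (Domain q \<union> Range q \<union> {k}) (h k)"
      using k(2) \<open>k \<notin> B\<close> by (auto simp: fresh_def X_def B_def F_def split: if_splits)
    then show ?thesis using k by (auto simp: addable_def X_def)
  qed
  then have "good_guess E n h ((\<lambda>k. (k, h k)) ` S)"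
    using S by (auto simp: good_guess_def)
  then show ?thesis ..
qed

text \<open>Three tasks alternate: totality, surjectivity, and realising a pair of the guess. The
  third asks for a pair outside \<open>q\<close>, so that infinitely many successes give infinitely
  many points of agreement.\<close>

definition next_stage ::
  "(nat \<Rightarrow> (nat \<Rightarrow> nat) set) \<Rightarrow> (nat \<Rightarrow> (nat \<times> nat) set) \<Rightarrow> nat \<Rightarrow> (nat \<times> nat) set \<Rightarrow> (nat \<times> nat) set \<Rightarrow> bool" where
  "next_stage E \<Gamma> j q q' \<longleftrightarrow>
     (q' = q \<or> (\<exists>k l. q' = insert (k, l) q \<and> addable (E j) q k l)) \<and>
     (j mod 3 = 0 \<longrightarrow> j div 3 \<in> Domain q') \<and>
     (j mod 3 = 1 \<longrightarrow> j div 3 \<in> Range q') \<and>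
     (j mod 3 = 2 \<longrightarrow> (\<exists>(k, l)\<in>\<Gamma> (j div 3). addable (E j) q k l) \<longrightarrow>
        (\<exists>(k, l)\<in>\<Gamma> (j div 3). (k, l) \<notin> q \<and> (k, l) \<in> q'))"

lemma ex_next_stage:
  assumes "finite q" "finite (E j)" "\<And>\<gamma>. \<gamma> \<in> E j \<Longrightarrow> bij \<gamma> \<and> cof \<gamma>"
  shows "\<exists>q'. next_stage E \<Gamma> j q q'"
proof -
  consider "j mod 3 = 0" | "j mod 3 = 1" | "j mod 3 = 2" by linarith
  then show ?thesis
  proof cases
    case 1
    show ?thesis
    proof (cases "j div 3 \<in> Domain q")
      case True
      then show ?thesis using 1 by (intro exI[of _ q]) (simp add: next_stage_def)
    next
      case False
      then obtain l where "addable (E j) q (j div 3) l"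
        using addable_domain[of q "E j" "j div 3"] assms by auto
      then show ?thesis
        using 1 by (intro exI[of _ "insert (j div 3, l) q"]) (auto simp: next_stage_def)
    qed
  next
    case 2
    show ?thesis
    proof (cases "j div 3 \<in> Range q")
      case True
      then show ?thesis using 2 by (intro exI[of _ q]) (simp add: next_stage_def)
    next
      case False
      then obtain k where "addable (E j) q k (j div 3)"
        using addable_range[of q "E j" "j div 3"] assms by auto
      then show ?thesis
        using 2 by (intro exI[of _ "insert (k, j div 3) q"]) (auto simp: next_stage_def)
    qed
  next
    case 3
    show ?thesis
    proof (cases "\<exists>(k, l)\<in>\<Gamma> (j div 3). addable (E j) q k l")
      case False
      then show ?thesis using 3 by (intro exI[of _ q]) (auto simp: next_stage_def)
    next
      case True
      then obtain k l where kl: "(k, l) \<in> \<Gamma> (j div 3)" "addable (E j) q k l" by blast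
      then have "(k, l) \<notin> q" by (auto simp: addable_def)
      with kl show ?thesis
        using 3 by (intro exI[of _ "insert (k, l) q"]) (auto simp: next_stage_def)
    qed
  qed
qed

text \<open>\<open>r\<close> is the union of a chain of stages. Stage \<open>j\<close> respects only
  the finite set \<open>E j\<close>, but these sets exhaust \<open>G\<close>, so the coefficients of
  each word are respected from some stage on.\<close>

lemma ex_generic_permutation:
  fixes G :: "(nat \<Rightarrow> nat) set"
  assumes G: "perm_group G" and cofG: "\<forall>\<gamma>\<in>G. cof \<gamma>"
    and E: "mono E" "(\<Union>j. E j) = G" "\<And>j. finite (E j)" "\<And>j \<gamma>. \<gamma> \<in> E j \<Longrightarrow> pinv \<gamma> \<in> E j"
  shows "\<exists>r. bij r \<and> r \<notin> G \<and>
     (\<forall>ws. \<forall>\<gamma>\<in>G. fst ` set ws \<subseteq> G \<longrightarrow> cof (word_eval r ws \<circ> \<gamma>)) \<and>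
     (\<forall>h. infinite {n. good_guess (E (3 * n + 2)) (3 * n + 2) h (\<Gamma> n)} \<longrightarrow> infinite {k. r k = h k})"
proof -
  have Eb: "bij \<gamma> \<and> cof \<gamma>" if "\<gamma> \<in> E j" for j \<gamma>
    using that E(2) perm_groupD(1)[OF G] cofG by blast
  have "\<exists>q. \<forall>j. ((j = 0 \<longrightarrow> q j = {}) \<and> finite (q j)) \<and> next_stage E \<Gamma> j (q j) (q (Suc j))"
  proof (rule dependent_nat_choice)
    fix q and j :: nat assume "(j = 0 \<longrightarrow> q = {}) \<and> finite (q :: (nat \<times> nat) set)"
    then obtain q' where "next_stage E \<Gamma> j q q'"
      using ex_next_stage[of q E j] E(3) Eb by blast
    moreover from this have "finite q'"
      using \<open>_ \<and> finite q\<close> by (auto simp: next_stage_def)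
    ultimately show "\<exists>q'. ((Suc j = 0 \<longrightarrow> q' = {}) \<and> finite q') \<and> next_stage E \<Gamma> j q q'"
      by blast
  qed auto
  then obtain q where q0: "q 0 = {}" and fin: "\<And>j. finite (q j)"
    and nxt: "\<And>j. next_stage E \<Gamma> j (q j) (q (Suc j))"
    by metis
  have step: "q (Suc j) = q j \<or> (\<exists>k l. q (Suc j) = insert (k, l) (q j) \<and> addable (E j) (q j) k l)" for j
    using nxt by (simp add: next_stage_def)
  have "q j \<subseteq> q (Suc j)" for j
    using step[of j] by blast
  then have monoq: "i \<le> j \<Longrightarrow> q i \<subseteq> q j" for i j
    by (rule lift_Suc_mono_le)
  \<comment> \<open>This is the size bound under which \<open>good_guess\<close> promises an addable
    pair at stage \<open>3 * n + 2\<close>.\<close>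
  have card: "card (q j) \<le> j" for j
  proof (induction j)
    case (Suc j)
    then show ?case using step[of j] card_insert_le_m1 fin
      by (auto simp: card_insert_if)
  qed (simp add: q0)
  have inj: "(\<forall>k l l'. (k, l) \<in> q j \<longrightarrow> (k, l') \<in> q j \<longrightarrow> l = l') \<and>
             (\<forall>k k' l. (k, l) \<in> q j \<longrightarrow> (k', l) \<in> q j \<longrightarrow> k = k')" for j
  proof (induction j)
    case (Suc j)
    from step[of j] show ?case
    proof
      assume "\<exists>k l. q (Suc j) = insert (k, l) (q j) \<and> addable (E j) (q j) k l"
      then obtain k l where eq: "q (Suc j) = insert (k, l) (q j)" and "k \<notin> Domain (q j)" "l \<notin> Range (q j)"
        by (auto simp: addable_def)
      then have "\<forall>x. (k, x) \<notin> q j" "\<forall>x. (x, l) \<notin> q j" by blast+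
      with Suc show ?thesis unfolding eq by auto
    qed (use Suc in simp)
  qed (simp add: q0)
  have unique1: "l = l'" if "(k, l) \<in> q i" "(k, l') \<in> q j" for i j k l l'
    using that monoq[of i "max i j"] monoq[of j "max i j"] inj[of "max i j"] by (meson max.cobounded1 max.cobounded2 subsetD)
  have unique2: "k = k'" if "(k, l) \<in> q i" "(k', l) \<in> q j" for i j k k' l
    using that monoq[of i "max i j"] monoq[of j "max i j"] inj[of "max i j"] by (meson max.cobounded1 max.cobounded2 subsetD)
  have dom: "\<exists>l. (n, l) \<in> q (Suc (3 * n))" for n
    using nxt[of "3 * n"] by (auto simp: next_stage_def)
  have ran: "\<exists>k. (k, n) \<in> q (Suc (3 * n + 1))" for n
  proof -
    have "(3 * n + 1) mod 3 = 1" "(3 * n + 1) div 3 = n" by auto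
    with nxt[of "3 * n + 1"] show ?thesis
      unfolding next_stage_def by (metis RangeE)
  qed
  define r where "r n = (SOME l. (n, l) \<in> q (Suc (3 * n)))" for n
  have rq: "(n, r n) \<in> q (Suc (3 * n))" for n
    unfolding r_def by (rule someI_ex[OF dom])
  have r_eq: "r k = l" if "(k, l) \<in> q j" for k l j
    using unique1[OF rq that] .
  have "inj r"
    by (rule injI) (metis rq unique2)
  moreover have "surj r"
    unfolding surj_def using ran r_eq by metis
  ultimately have bijr: "bij r" by (simp add: bij_def)
  have red: "finite {z. word_eval r ws z = z}" if "ws \<noteq> []" "cyc_reduced ws" "fst ` set ws \<subseteq> G" for ws
    by (rule cof_reduced_word_of_chain[OF bijr _ fin step E(1)]) (use rq that E(2,4) Eb in auto)
  have words: "cof (word_eval r ws \<circ> \<gamma>)" if "fst ` set ws \<subseteq> G" "\<gamma> \<in> G" for ws \<gamma>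
    by (rule cof_words_if_cof_reduced_words[OF bijr G cofG _ that]) (simp add: red cof_def)
  have "r \<notin> G"
  proof
    assume "r \<in> G"
    \<comment> \<open>This one-letter word is cyclically reduced and yet evaluates to the
      identity.\<close>
    then have *: "fst ` set [(pinv r, True)] \<subseteq> G" using perm_groupD(4)[OF G] by simp
    have "finite {z. word_eval r [(pinv r, True)] z = z}"
      by (rule red[OF _ _ *]) (auto simp: cyc_reduced_def letter_def)
    then show False using bijr by (simp add: spow_def)
  qed
  moreover have "infinite {k. r k = h k}"
    if h: "infinite {n. good_guess (E (3 * n + 2)) (3 * n + 2) h (\<Gamma> n)}" for h
  proof
    assume F: "finite {k. r k = h k}"
    have "\<exists>j. (k, r k) \<in> q j" for k using rq by blast
    then have "(\<lambda>k. (k, r k)) ` {k. r k = h k} \<subseteq> (\<Union>j. q j)" by (metis (no_types, lifting) UN_I UNIV_I image_subsetI)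
    then obtain N where N: "(\<lambda>k. (k, r k)) ` {k. r k = h k} \<subseteq> q N"
      using finite_subset_mono_UN[of _ q] F monoq by (meson finite_imageI monoI)
    \<comment> \<open>All agreements lie in \<open>q N\<close>, but a good guess at a later stage
      adds an agreement outside it.\<close>
    obtain n where n: "n \<ge> N" "good_guess (E (3 * n + 2)) (3 * n + 2) h (\<Gamma> n)"
      using h by (auto simp: infinite_nat_iff_unbounded_le)
    have "\<exists>(k, l)\<in>\<Gamma> n. addable (E (3 * n + 2)) (q (3 * n + 2)) k l"
      using n(2) fin card by (auto simp: good_guess_def)
    moreover have "(3 * n + 2) mod 3 = 2" "(3 * n + 2) div 3 = n" by presburger+
    ultimately obtain k l where kl: "(k, l) \<in> \<Gamma> n" "(k, l) \<notin> q (3 * n + 2)" "(k, l) \<in> q (Suc (3 * n + 2))"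
      using nxt[of "3 * n + 2"] by (auto simp: next_stage_def)
    then have "r k = h k" "l = r k"
      using n(2) r_eq by (auto simp: good_guess_def)
    then have "(k, l) \<in> q N" using N by auto
    with kl(2) monoq[of N "3 * n + 2"] n(1) show False by auto
  qed
  ultimately show ?thesis using bijr words by blast
qed

subsection \<open>Groups generated by families of permutations\<close>

fun gen_word :: "('i \<Rightarrow> 'a \<Rightarrow> 'a) \<Rightarrow> ('i \<times> bool) list \<Rightarrow> 'a \<Rightarrow> 'a" where
  "gen_word g [] = id"
| "gen_word g ((\<alpha>, b) # u) = spow (g \<alpha>) b \<circ> gen_word g u"

definition perm_span :: "('i \<Rightarrow> 'a \<Rightarrow> 'a) \<Rightarrow> 'i set \<Rightarrow> ('a \<Rightarrow> 'a) set" where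
  "perm_span g A = gen_word g ` {u. fst ` set u \<subseteq> A}"

text \<open>For finite \<open>A\<close> these pieces are finite, and for bijective generators
  inversion preserves the word length; they will serve as the sets \<open>E j\<close>.\<close>

definition perm_span_upto :: "('i \<Rightarrow> 'a \<Rightarrow> 'a) \<Rightarrow> 'i set \<Rightarrow> nat \<Rightarrow> ('a \<Rightarrow> 'a) set" where
  "perm_span_upto g A n = gen_word g ` {u. fst ` set u \<subseteq> A \<and> length u \<le> n}"

lemma gen_word_append: "gen_word g (u @ v) = gen_word g u \<circ> gen_word g v"
  by (induction u) (auto simp: comp_assoc)

lemma bij_gen_word: "\<forall>\<alpha>\<in>fst ` set u. bij (g \<alpha>) \<Longrightarrow> bij (gen_word g u)"
proof (induction u)
  case (Cons a u)
  obtain \<alpha> b where a: "a = (\<alpha>, b)" by force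
  have "bij (gen_word g u)" "bij (g \<alpha>)" using Cons a by auto
  then show ?case
    unfolding a gen_word.simps by (intro bij_comp bij_spow)
qed simp

lemma pinv_spow: "bij r \<Longrightarrow> pinv (spow r b) = spow r (\<not> b)"
  by (simp add: spow_def inv_inv_eq)

lemma gen_word_inverse:
  "\<forall>\<alpha>\<in>fst ` set u. bij (g \<alpha>) \<Longrightarrow> pinv (gen_word g u) = gen_word g (rev (map (apsnd Not) u))"
proof (induction u)
  case (Cons a u)
  obtain \<alpha> b where a: "a = (\<alpha>, b)" by force
  have u: "pinv (gen_word g u) = gen_word g (rev (map (apsnd Not) u))" "bij (gen_word g u)"
    and \<alpha>: "bij (g \<alpha>)"
    using Cons a by (auto intro: bij_gen_word)
  have "gen_word g (rev (map (apsnd Not) (a # u))) = pinv (gen_word g u) \<circ> pinv (spow (g \<alpha>) b)"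
    by (simp add: a u pinv_spow[OF \<alpha>] gen_word_append)
  then show ?case
    unfolding a gen_word.simps using o_inv_distrib[OF bij_spow[OF \<alpha>] u(2)] by metis
qed simp

lemma gen_word_cong: "(\<And>\<alpha>. \<alpha> \<in> fst ` set u \<Longrightarrow> g \<alpha> = g' \<alpha>) \<Longrightarrow> gen_word g u = gen_word g' u"
  by (induction u) auto

lemma perm_span_cong: "(\<And>\<alpha>. \<alpha> \<in> A \<Longrightarrow> g \<alpha> = g' \<alpha>) \<Longrightarrow> perm_span g A = perm_span g' A"
  unfolding perm_span_def by (intro image_cong refl gen_word_cong) auto

lemma perm_span_upto_cong: "(\<And>\<alpha>. \<alpha> \<in> A \<Longrightarrow> g \<alpha> = g' \<alpha>) \<Longrightarrow> perm_span_upto g A n = perm_span_upto g' A n"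
  unfolding perm_span_upto_def by (intro image_cong refl gen_word_cong) auto

lemma perm_span_mono: "A \<subseteq> B \<Longrightarrow> perm_span g A \<subseteq> perm_span g B"
  by (auto simp: perm_span_def)

lemma perm_span_upto_subset: "A \<subseteq> B \<Longrightarrow> perm_span_upto g A n \<subseteq> perm_span g B"
  by (auto simp: perm_span_def perm_span_upto_def)

lemma generator_in_span: "\<alpha> \<in> A \<Longrightarrow> g \<alpha> \<in> perm_span g A"
  unfolding perm_span_def by (rule image_eqI[of _ _ "[(\<alpha>, True)]"]) (auto simp: spow_def)

lemma perm_group_span:
  assumes "\<forall>\<alpha>\<in>A. bij (g \<alpha>)"
  shows "perm_group (perm_span g A)"
  unfolding perm_group_def
proof (intro conjI ballI)
  show "bij k" if "k \<in> perm_span g A" for k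
    using that assms by (auto simp: perm_span_def intro!: bij_gen_word)
  show "id \<in> perm_span g A"
    unfolding perm_span_def by (rule image_eqI[of _ _ "[]"]) auto
  show "k \<circ> l \<in> perm_span g A" if kl: "k \<in> perm_span g A" "l \<in> perm_span g A" for k l
  proof -
    from kl obtain u v where "k = gen_word g u" "fst ` set u \<subseteq> A" "l = gen_word g v" "fst ` set v \<subseteq> A"
      by (auto simp: perm_span_def)
    then show ?thesis
      unfolding perm_span_def by (intro image_eqI[of _ _ "u @ v"]) (auto simp: gen_word_append)
  qed
  show "pinv k \<in> perm_span g A" if "k \<in> perm_span g A" for k
  proof -
    from that obtain u where "k = gen_word g u" "fst ` set u \<subseteq> A"
      by (auto simp: perm_span_def)
    then show ?thesis
      unfolding perm_span_def using assms
      by (intro image_eqI[of _ _ "rev (map (apsnd Not) u)"]) (auto simp: gen_word_inverse subset_iff)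
  qed
qed

lemma pinv_perm_span_upto:
  assumes "\<forall>\<alpha>\<in>A. bij (g \<alpha>)" "k \<in> perm_span_upto g A n"
  shows "pinv k \<in> perm_span_upto g A n"
proof -
  from assms(2) obtain u where "k = gen_word g u" "fst ` set u \<subseteq> A" "length u \<le> n"
    by (auto simp: perm_span_upto_def)
  then show ?thesis
    unfolding perm_span_upto_def using assms(1)
    by (intro image_eqI[of _ _ "rev (map (apsnd Not) u)"]) (auto simp: gen_word_inverse subset_iff)
qed

lemma finite_perm_span_upto:
  assumes "finite A"
  shows "finite (perm_span_upto g A n)"
proof -
  have "{u :: ('a \<times> bool) list. fst ` set u \<subseteq> A \<and> length u \<le> n} \<subseteq> {u. set u \<subseteq> A \<times> UNIV \<and> length u \<le> n}"
    by force
  then show ?thesis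
    unfolding perm_span_upto_def
    using assms finite_lists_length_le[of "A \<times> (UNIV :: bool set)" n]
    by (intro finite_imageI) (auto intro: finite_subset)
qed

text \<open>With each element as its own index, an arbitrary group becomes a span, so that
  \<open>cof_span_insert\<close> applies to it.\<close>

lemma span_id_perm_group:
  assumes "perm_group M"
  shows "perm_span id M = M"
proof
  have "gen_word id u \<in> M" if "fst ` set u \<subseteq> M" for u
    using that
  proof (induction u)
    case Nil
    show ?case unfolding gen_word.simps by (rule perm_groupD(2)[OF assms])
  next
    case (Cons a u)
    obtain \<gamma> b where a: "a = (\<gamma>, b)" by force
    have "fst ` set u \<subseteq> M" "\<gamma> \<in> M"
      using Cons.prems a by auto
    then have "gen_word id u \<in> M" "spow (id \<gamma>) b \<in> M"
      using Cons.IH perm_groupD(4)[OF assms] by (blast, simp add: spow_def)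
    then show ?case
      unfolding a gen_word.simps by (intro perm_groupD(3)[OF assms])
  qed
  then show "perm_span id M \<subseteq> M" by (auto simp: perm_span_def)
  show "M \<subseteq> perm_span id M" using generator_in_span[of _ M id] by auto
qed

text \<open>Blocks of letters from \<open>A\<close> become coefficients. A letter
  \<open>\<delta>\<close> opens a pair with coefficient \<open>id\<close>; any other letter is
  multiplied into the leading coefficient, or into \<open>\<gamma>\<close> if there is no pair
  yet.\<close>

lemma gen_word_eq_word_eval:
  assumes "\<forall>\<alpha>\<in>A. bij (g \<alpha>)" "\<delta> \<notin> A" "fst ` set u \<subseteq> insert \<delta> A"
  shows "\<exists>ws \<gamma>. fst ` set ws \<subseteq> perm_span g A \<and> \<gamma> \<in> perm_span g A \<and>
           gen_word (g(\<delta> := r)) u = word_eval r ws \<circ> \<gamma>"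
  using assms(3)
proof (induction u)
  case Nil
  then show ?case
    using perm_groupD(2)[OF perm_group_span[OF assms(1)]]
    by (intro exI[of _ "[]"] exI[of _ id]) (auto simp only: gen_word.simps word_eval.simps comp_id list.set image_empty)
next
  case (Cons a u)
  note S = perm_groupD[OF perm_group_span[OF assms(1)]]
  obtain \<alpha> b where a: "a = (\<alpha>, b)" by force
  obtain ws \<gamma> where IH: "fst ` set ws \<subseteq> perm_span g A" "\<gamma> \<in> perm_span g A"
    "gen_word (g(\<delta> := r)) u = word_eval r ws \<circ> \<gamma>"
    using Cons.IH Cons.prems by (metis image_mono order_trans set_subset_Cons)
  show ?case
  proof (cases "\<alpha> = \<delta>")
    case True
    have "gen_word (g(\<delta> := r)) (a # u) = word_eval r ((id, b) # ws) \<circ> \<gamma>"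
      unfolding a gen_word.simps word_eval.simps IH(3) by (simp only: True fun_upd_same comp_assoc id_comp)
    moreover have "fst ` set ((id, b) # ws) \<subseteq> perm_span g A"
      using IH(1) S(2) by auto
    ultimately show ?thesis
      using IH(2) by (intro exI[of _ "(id, b) # ws"] exI[of _ \<gamma>] conjI)
  next
    case False
    have step: "gen_word (g(\<delta> := r)) (a # u) = spow (g \<alpha>) b \<circ> word_eval r ws \<circ> \<gamma>"
      unfolding a gen_word.simps IH(3) by (simp only: fun_upd_other[OF False] comp_assoc)
    have \<alpha>: "\<alpha> \<in> A" using False Cons.prems a by simp
    have c: "spow (g \<alpha>) b \<in> perm_span g A"
      using S(4) generator_in_span[OF \<alpha>] by (auto simp: spow_def)
    show ?thesis
    proof (cases ws)
      case Nil
      have "gen_word (g(\<delta> := r)) (a # u) = word_eval r [] \<circ> (spow (g \<alpha>) b \<circ> \<gamma>)"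
        unfolding step Nil word_eval.simps by (simp only: comp_id id_comp)
      moreover have "fst ` set [] \<subseteq> perm_span g A" by simp
      ultimately show ?thesis
        using S(3)[OF c IH(2)] by (intro exI[of _ "[]"] exI[of _ "spow (g \<alpha>) b \<circ> \<gamma>"] conjI)
    next
      case (Cons p vs)
      obtain \<gamma>1 b1 where p: "p = (\<gamma>1, b1)" by force
      have "\<gamma>1 \<in> perm_span g A" "fst ` set vs \<subseteq> perm_span g A"
        using IH(1) by (auto simp: Cons p)
      then have "fst ` set ((spow (g \<alpha>) b \<circ> \<gamma>1, b1) # vs) \<subseteq> perm_span g A"
        using S(3)[OF c] by auto
      moreover have "gen_word (g(\<delta> := r)) (a # u) = word_eval r ((spow (g \<alpha>) b \<circ> \<gamma>1, b1) # vs) \<circ> \<gamma>"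
        unfolding step Cons p word_eval.simps by (simp only: comp_assoc)
      ultimately show ?thesis
        using IH(2) by (intro exI[of _ "(spow (g \<alpha>) b \<circ> \<gamma>1, b1) # vs"] exI[of _ \<gamma>] conjI)
    qed
  qed
qed

lemma cof_span_insert:
  assumes "\<forall>\<alpha>\<in>A. bij (g \<alpha>)" "\<delta> \<notin> A"
    and "\<forall>ws. \<forall>\<gamma>\<in>perm_span g A. fst ` set ws \<subseteq> perm_span g A \<longrightarrow> cof (word_eval r ws \<circ> \<gamma>)"
    and "k \<in> perm_span (g(\<delta> := r)) (insert \<delta> A)"
  shows "cof k"
  using assms(3,4) gen_word_eq_word_eval[OF assms(1,2), where r = r]
  unfolding perm_span_def[of "g(\<delta> := r)"] by (smt (verit) imageE mem_Collect_eq)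

text \<open>A generic permutation, built with empty guesses, generates a larger cofinitary group
  together with \<open>M\<close>. This yields the lower bound for the cardinal.\<close>

lemma countable_cofinitary_group_not_maximal:
  assumes "cofinitary_group M" "countable M"
  shows "\<not> max_cofinitary_group M"
proof -
  have M: "perm_group M" and cofM: "\<forall>\<gamma>\<in>M. cof \<gamma>"
    using assms(1) by (auto simp: cofinitary_group_iff)
  have Mb: "\<forall>\<gamma>\<in>M. bij (id \<gamma>)" using perm_groupD(1)[OF M] by simp
  have ne: "M \<noteq> {}" using perm_groupD(2)[OF M] by auto
  define E where "E j = from_nat_into M ` {..j} \<union> pinv ` from_nat_into M ` {..j}" for j :: nat
  have in_M: "from_nat_into M i \<in> M" for i using ne by (rule from_nat_into)
  have "\<exists>r. bij r \<and> r \<notin> M \<and>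
     (\<forall>ws. \<forall>\<gamma>\<in>M. fst ` set ws \<subseteq> M \<longrightarrow> cof (word_eval r ws \<circ> \<gamma>)) \<and>
     (\<forall>h. infinite {n. good_guess (E (3 * n + 2)) (3 * n + 2) h ({} :: (nat \<times> nat) set)} \<longrightarrow> infinite {k. r k = h k})"
  proof (rule ex_generic_permutation[OF M cofM])
    show "mono E" by (fastforce simp: E_def mono_def)
    have "M \<subseteq> (\<Union>j. E j)"
    proof
      fix \<gamma> assume "\<gamma> \<in> M"
      then obtain i where "from_nat_into M i = \<gamma>" using from_nat_into_surj[OF assms(2)] by blast
      then show "\<gamma> \<in> (\<Union>j. E j)" by (auto simp: E_def)
    qed
    then show "(\<Union>j. E j) = M"
      using in_M perm_groupD(4)[OF M] by (auto simp: E_def)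
    show "finite (E j)" for j by (simp add: E_def)
    show "pinv \<gamma> \<in> E j" if "\<gamma> \<in> E j" for j \<gamma>
      using that perm_groupD(1)[OF M in_M] by (auto simp: E_def inv_inv_eq)
  qed
  then obtain r where r: "bij r" "r \<notin> M"
    "\<forall>ws. \<forall>\<gamma>\<in>M. fst ` set ws \<subseteq> M \<longrightarrow> cof (word_eval r ws \<circ> \<gamma>)"
    by blast
  define H where "H = perm_span id (insert r M)"
  have upd: "id(r := r) = id" by (rule fun_upd_idem) simp
  have "perm_group H"
    unfolding H_def by (rule perm_group_span) (use Mb r(1) in auto)
  moreover have "cof k" if "k \<in> H" for k
    using cof_span_insert[OF Mb r(2), unfolded span_id_perm_group[OF M], OF r(3)] that
    unfolding H_def upd .
  ultimately have "cofinitary_group H" by (simp add: cofinitary_group_iff)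
  moreover have "M \<subset> H"
    using perm_span_mono[of M "insert r M" id] generator_in_span[of r "insert r M" id] r(2)
    by (auto simp: span_id_perm_group[OF M] H_def)
  ultimately show ?thesis by (auto simp: max_cofinitary_group_def)
qed

subsection \<open>Coding below ordinals of a club\<close>

lemma omega1_countable_initial:
  "is_omega1_type TYPE('w::wellorder) \<Longrightarrow> countable {x::'w. x < a}"
  by (simp add: is_omega1_type_def)

lemma omega1_countable_bounded:
  fixes A :: "'w::wellorder set"
  assumes "is_omega1_type TYPE('w)" "countable A"
  shows "\<exists>u. \<forall>a\<in>A. a < u"
proof (rule ccontr)
  assume "\<nexists>u. \<forall>a\<in>A. a < u"
  then have "\<exists>a\<in>A. u \<in> insert a {x. x < a}" for u
    by (metis insertI1 insertI2 mem_Collect_eq not_less_iff_gr_or_eq)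
  then have "UNIV \<subseteq> (\<Union>a\<in>A. insert a {x. x < a})" by blast
  moreover have "countable (\<Union>a\<in>A. insert a {x. x < a})"
    using assms(2) omega1_countable_initial[OF assms(1)] by simp
  ultimately have "countable (UNIV :: 'w set)" by (rule countable_subset)
  then show False using assms(1) by (simp add: is_omega1_type_def)
qed

lemma omega1_lepoll_uncountable:
  fixes M :: "'a set"
  assumes "is_omega1_type TYPE('w::wellorder)" "uncountable M"
  shows "(UNIV :: 'w set) \<lesssim> M"
proof -
  have "\<exists>f. \<forall>x::'w. f x \<in> M \<and> f x \<notin> f ` {y. y < x}"
  proof (rule dependent_wellorder_choice)
    show "(r \<in> M \<and> r \<notin> f ` {y. y < x}) = (r \<in> M \<and> r \<notin> g ` {y. y < x})"
      if "\<And>y. y < x \<Longrightarrow> f y = g y" for r and f g :: "'w \<Rightarrow> 'a" and x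
      using that by (simp cong: image_cong_simp)
    show "\<exists>r. r \<in> M \<and> r \<notin> f ` {y. y < x}" for f :: "'w \<Rightarrow> 'a" and x
      using countable_subset[of M "f ` {y. y < x}"] assms(2) omega1_countable_initial[OF assms(1), of x]
      by (meson countable_image subsetI)
  qed
  then obtain f :: "'w \<Rightarrow> 'a" where f: "\<And>x. f x \<in> M" "\<And>x. f x \<notin> f ` {y. y < x}" by auto
  have "inj f"
  proof (rule linorder_injI)
    fix x y :: 'w assume "x < y"
    then have "f x \<in> f ` {z. z < y}" by blast
    then show "f x \<noteq> f y" using f(2)[of y] by metis
  qed
  then show ?thesis unfolding lepoll_def using f(1) by (intro exI[of _ f]) auto
qed

text \<open>Lists are folded with a pairing function \<open>J\<close>. The fold separates lists of
  equal length, so the length is coded beside it.\<close>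

lemma ex_inj_lists:
  assumes "infinite (UNIV :: 'w set)"
  shows "\<exists>\<iota> :: 'w list \<times> nat \<times> nat \<Rightarrow> 'w. inj \<iota>"
proof -
  have "\<exists>J :: 'w \<times> 'w \<Rightarrow> 'w. bij_betw J (UNIV \<times> UNIV) UNIV"
    using card_of_Times_same_infinite[OF assms] card_of_ordIso by blast
  then obtain J :: "'w \<times> 'w \<Rightarrow> 'w" where J: "inj J"
    by (auto simp: bij_betw_def)
  obtain N :: "nat \<Rightarrow> 'w" where N: "inj N"
    using infinite_countable_subset[OF assms] by blast
  define c where "c xs = foldr (\<lambda>x y. J (x, y)) xs (N 0)" for xs
  have c_inj: "length xs = length ys \<Longrightarrow> c xs = c ys \<Longrightarrow> xs = ys" for xs ys
    by (induction xs ys rule: list_induct2) (auto simp: c_def dest: injD[OF J])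
  have "inj (\<lambda>(xs, i, j). J (J (N (length xs), c xs), J (N i, N j)))"
    by (rule injI) (auto dest!: injD[OF J] injD[OF N] intro: c_inj)
  then show ?thesis by blast
qed

text \<open>Below any point there are only countably many lists, so their codes are bounded;
  iterating such bounds \<open>\<omega>\<close> times leads to a closure point.\<close>

lemma club_closed_under_codes:
  fixes \<iota> :: "'w::wellorder list \<times> nat \<times> nat \<Rightarrow> 'w"
  assumes "is_omega1_type TYPE('w)"
  shows "club {d. \<forall>xs j m. (\<forall>x\<in>set xs. x < d) \<longrightarrow> \<iota> (xs, j, m) < d}" (is "club ?C")
  unfolding club_def
proof (intro conjI allI impI)
  fix b :: 'w
  have "\<exists>u. \<forall>y\<in>insert x (\<iota> ` (lists (insert x {z. z < x}) \<times> UNIV)). y < u" for x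
    using omega1_countable_initial[OF assms, of x]
    by (intro omega1_countable_bounded[OF assms] countable_insert countable_image countable_SIGMA
        countable_lists) auto
  then obtain \<phi> where \<phi>: "\<And>x y. y \<in> insert x (\<iota> ` (lists (insert x {z. z < x}) \<times> UNIV)) \<Longrightarrow> y < \<phi> x"
    by metis
  have \<phi>_gt: "x < \<phi> x" for x using \<phi> by simp
  have \<phi>_code: "\<iota> (xs, j, m) < \<phi> x" if "\<forall>z\<in>set xs. z \<le> x" for xs j m x
  proof -
    have "xs \<in> lists (insert x {z. z < x})" using that by auto
    then show ?thesis by (intro \<phi>) auto
  qed
  define s where "s n = (\<phi> ^^ n) b" for n
  have "s n < s (Suc n)" for n by (simp add: s_def \<phi>_gt)
  then have mono_s: "strict_mono s" by (simp add: strict_mono_Suc_iff)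
  obtain u where u: "\<forall>y\<in>range s. y < u"
    using omega1_countable_bounded[OF assms, of "range s"] by auto
  \<comment> \<open>The supremum of the iterates: a finite list below \<open>c\<close> is bounded by
    some \<open>s n\<close>, and its codes then lie below \<open>s (Suc n)\<close>.\<close>
  define c where "c = (LEAST u. \<forall>y\<in>range s. y < u)"
  have c: "s n < c" for n
    using LeastI[of "\<lambda>u. \<forall>y\<in>range s. y < u", OF u] by (simp add: c_def)
  have below_c: "\<exists>n. x \<le> s n" if "x < c" for x
    using not_less_Least[OF that[unfolded c_def]] by (auto simp: not_less)
  have "\<exists>n. \<forall>x\<in>set xs. x \<le> s n" if "\<forall>x\<in>set xs. x < c" for xs
    using that
  proof (induction xs)
    case (Cons x xs)
    then obtain n where n: "\<forall>x\<in>set xs. x \<le> s n" by auto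
    obtain k where "x \<le> s k" using Cons.prems below_c[of x] by auto
    moreover have "s n \<le> s (max n k)" "s k \<le> s (max n k)"
      using mono_s by (simp_all add: strict_mono_less_eq)
    ultimately have "\<forall>y\<in>set (x # xs). y \<le> s (max n k)" using n by fastforce
    then show ?case ..
  qed simp
  then have "\<iota> (xs, j, m) < c" if "\<forall>x\<in>set xs. x < c" for xs j m
    using that \<phi>_code c by (metis (no_types, lifting) comp_apply funpow.simps(2) less_trans s_def)
  then have "c \<in> ?C" by blast
  moreover have "b < c" using c[of 0] by (simp add: s_def)
  ultimately show "\<exists>c\<in>?C. b < c" by blast
next
  fix a
  assume a: "(\<exists>c\<in>?C. c < a) \<and> (\<forall>b<a. \<exists>c\<in>?C. b < c \<and> c < a)"
  have *: "\<exists>c\<in>?C. c < a \<and> (\<forall>x\<in>set xs. x < c)" if xs: "\<forall>x\<in>set xs. x < a" for xs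
  proof (cases "xs = []")
    case True
    then show ?thesis using a by auto
  next
    case False
    then have "Max (set xs) < a" using xs by simp
    then obtain c where "c \<in> ?C" "Max (set xs) < c" "c < a" using a by blast
    then show ?thesis using False by (intro bexI[of _ c]) auto
  qed
  have "\<iota> (xs, j, m) < a" if "\<forall>x\<in>set xs. x < a" for xs j m
  proof -
    obtain c where "c \<in> ?C" "c < a" "\<forall>x\<in>set xs. x < c"
      using * \<open>\<forall>x\<in>set xs. x < a\<close> by blast
    then have "\<iota> (xs, j, m) < c" by blast
    then show ?thesis using \<open>c < a\<close> by (rule less_trans)
  qed
  then show "a \<in> ?C" by blast
qed

text \<open>Each value is a least \<open>m\<close> over countably many conditions, each reading one
  coordinate of \<open>s\<close>, and coordinates are continuous. The guard
  \<open>c d n m < d\<close> restricts to coordinates of the space at \<open>d\<close>.\<close>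

lemma borel_F_Least_coordinate:
  fixes c :: "'w::wellorder \<Rightarrow> nat \<Rightarrow> nat \<Rightarrow> 'w"
  shows "borel_F (\<lambda>d s n. LEAST m. c d n m < d \<and> s (c d n m))"
  unfolding borel_F_def
proof
  fix d :: 'w
  let ?M = "borel_of_top (cantor_top d)"
  have sp: "space ?M = topspace (cantor_top d)"
    by (simp add: borel_of_top_def space_measure_of_conv)
  have open_sets: "U \<in> sets ?M" if "openin (cantor_top d) U" for U
    using that openin_subset by (subst borel_of_top_def, subst sets_measure_of) (auto intro!: sigma_sets.Basic)
  have "{s \<in> space ?M. x < d \<and> s x} \<in> sets ?M" for x
  proof (cases "x < d")
    case True
    then have "continuous_map (cantor_top d) euclidean (\<lambda>s. s x)"
      unfolding cantor_top_def by (intro continuous_map_product_projection) auto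
    then have "openin (cantor_top d) {s \<in> topspace (cantor_top d). s x \<in> {True}}"
      by (rule openin_continuous_map_preimage) (simp add: open_discrete)
    then show ?thesis using True open_sets by (simp add: sp)
  qed simp
  then have pred: "(\<lambda>s. x < d \<and> s x) \<in> measurable ?M (count_space UNIV)" for x
    by (simp add: pred_def)
  have count_borel: "sets (borel :: nat measure) = sets (count_space UNIV)"
    by (simp add: sets_borel_eq_count_space)
  show "(\<lambda>s n. LEAST m. c d n m < d \<and> s (c d n m)) \<in> measurable ?M borel"
    by (intro measurable_coordinatewise_then_product, subst measurable_cong_sets[OF refl count_borel])
       (intro measurable_Least pred)
qed

text \<open>A finite exhaustion of the predecessors of \<open>d\<close> that depends on
  \<open>d\<close> alone, so it is available before any generators exist.\<close>

definition initial_part :: "'w::wellorder \<Rightarrow> nat \<Rightarrow> 'w set" where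
  "initial_part d j = {x. x < d \<and> to_nat_on {x. x < d} x \<le> j}"

lemma initial_part_less: "x \<in> initial_part d j \<Longrightarrow> x < d"
  by (simp add: initial_part_def)

lemma finite_initial_part:
  fixes d :: "'w::wellorder"
  assumes "is_omega1_type TYPE('w)"
  shows "finite (initial_part d j)"
proof (rule finite_imageD)
  show "finite (to_nat_on {x. x < d} ` initial_part d j)"
    by (rule finite_subset[of _ "{..j}"]) (auto simp: initial_part_def)
  show "inj_on (to_nat_on {x. x < d}) (initial_part d j)"
    by (rule inj_on_subset[OF inj_on_to_nat_on[OF omega1_countable_initial[OF assms]]])
       (auto simp: initial_part_def)
qed

lemma mono_initial_part: "mono (initial_part d)"
  by (auto simp: mono_def initial_part_def)

lemma Union_initial_part: "(\<Union>j. initial_part d j) = {x. x < d}"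
  by (auto simp: initial_part_def)

lemma Union_perm_span_upto:
  assumes "mono A"
  shows "(\<Union>j. perm_span_upto g (A j) j) = perm_span g (\<Union>j. A j)"
proof
  show "(\<Union>j. perm_span_upto g (A j) j) \<subseteq> perm_span g (\<Union>j. A j)"
    by (intro UN_least perm_span_upto_subset) auto
  show "perm_span g (\<Union>j. A j) \<subseteq> (\<Union>j. perm_span_upto g (A j) j)"
  proof
    fix k assume "k \<in> perm_span g (\<Union>j. A j)"
    then obtain u where u: "k = gen_word g u" "fst ` set u \<subseteq> (\<Union>j. A j)"
      by (auto simp: perm_span_def)
    then obtain N where "fst ` set u \<subseteq> A N"
      using finite_subset_mono_UN[OF _ assms, of "fst ` set u"] by auto
    then have "fst ` set u \<subseteq> A (max N (length u))"
      using monoD[OF assms, of N "max N (length u)"] by auto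
    then have "k \<in> perm_span_upto g (A (max N (length u))) (max N (length u))"
      unfolding perm_span_upto_def u(1) by (intro imageI) simp
    then show "k \<in> (\<Union>j. perm_span_upto g (A j) j)" by blast
  qed
qed

subsection \<open>The recursion of length \<open>\<omega>\<^sub>1\<close>\<close>

definition guess_stage :: "('w::wellorder \<Rightarrow> nat \<Rightarrow> nat) \<Rightarrow> 'w \<Rightarrow> nat \<Rightarrow> (nat \<times> nat) set" where
  "guess_stage \<Gamma> d n = set (from_nat (\<Gamma> d n))"

definition generic_step ::
  "('w::wellorder \<Rightarrow> nat \<Rightarrow> nat) \<Rightarrow> ('w \<Rightarrow> nat \<Rightarrow> nat) \<Rightarrow> 'w \<Rightarrow> (nat \<Rightarrow> nat) \<Rightarrow> bool" where
  "generic_step \<Gamma> g d r \<longleftrightarrow> bij r \<and> r \<notin> perm_span g {x. x < d} \<and>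
     (\<forall>k\<in>perm_span (g(d := r)) (insert d {x. x < d}). cof k) \<and>
     (\<forall>h. infinite {n. good_guess (perm_span_upto g (initial_part d (3 * n + 2)) (3 * n + 2)) (3 * n + 2) h
             (guess_stage \<Gamma> d n)} \<longrightarrow> infinite {k. r k = h k})"

text \<open>All letters involved lie below \<open>d\<close>, except \<open>d\<close> itself, whose
  value is overwritten by \<open>r\<close>. Recursion along the well-order requires this
  independence.\<close>

lemma generic_step_cong:
  assumes "\<And>y. y < d \<Longrightarrow> f y = g y"
  shows "generic_step \<Gamma> f d r \<longleftrightarrow> generic_step \<Gamma> g d r"
proof -
  have "perm_span f {x. x < d} = perm_span g {x. x < d}"
    using assms by (intro perm_span_cong) auto
  moreover have "perm_span (f(d := r)) (insert d {x. x < d}) = perm_span (g(d := r)) (insert d {x. x < d})"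
    using assms by (intro perm_span_cong) auto
  moreover have "perm_span_upto f (initial_part d j) j = perm_span_upto g (initial_part d j) j" for j
    using assms by (intro perm_span_upto_cong) (auto dest: initial_part_less)
  ultimately show ?thesis by (simp add: generic_step_def)
qed

text \<open>A nonempty word has a largest index \<open>a\<close>, and the step at \<open>a\<close>
  already covers it. This handles limit stages and the final group.\<close>

lemma cof_perm_span_if_generic_steps:
  assumes "\<And>x. x \<in> A \<Longrightarrow> generic_step \<Gamma> g x (g x)" "k \<in> perm_span g A"
  shows "cof k"
proof -
  from assms(2) obtain u where u: "k = gen_word g u" "fst ` set u \<subseteq> A"
    by (auto simp: perm_span_def)
  show ?thesis
  proof (cases "u = []")
    case True
    then show ?thesis by (simp add: u cof_def)
  next
    case False
    define a where "a = Max (fst ` set u)"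
    have "a \<in> A" using False u(2) Max_in[of "fst ` set u"] by (auto simp: a_def)
    have "fst ` set u \<subseteq> insert a {x. x < a}"
      using Max_ge[of "fst ` set u"] by (auto simp: a_def le_less)
    then have "k \<in> perm_span (g(a := g a)) (insert a {x. x < a})"
      unfolding perm_span_def u(1) fun_upd_triv by (intro imageI) simp
    then show ?thesis
      using assms(1)[OF \<open>a \<in> A\<close>] by (simp only: generic_step_def)
  qed
qed

lemma ex_generic_family:
  fixes \<Gamma> :: "'w::wellorder \<Rightarrow> nat \<Rightarrow> nat"
  assumes "is_omega1_type TYPE('w)"
  shows "\<exists>g. \<forall>d. generic_step \<Gamma> g d (g d)"
proof (rule dependent_wellorder_choice)
  show "generic_step \<Gamma> f x r = generic_step \<Gamma> g x r" if "\<And>y. y < x \<Longrightarrow> f y = g y" for r f g x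
    using that by (rule generic_step_cong)
  fix d and g :: "'w \<Rightarrow> nat \<Rightarrow> nat"
  assume IH: "\<And>y. y < d \<Longrightarrow> generic_step \<Gamma> g y (g y)"
  then have b: "\<forall>x\<in>{x. x < d}. bij (g x)" by (simp add: generic_step_def)
  define E where "E j = perm_span_upto g (initial_part d j) j" for j
  have "\<exists>r. bij r \<and> r \<notin> perm_span g {x. x < d} \<and>
     (\<forall>ws. \<forall>\<gamma>\<in>perm_span g {x. x < d}. fst ` set ws \<subseteq> perm_span g {x. x < d} \<longrightarrow> cof (word_eval r ws \<circ> \<gamma>)) \<and>
     (\<forall>h. infinite {n. good_guess (E (3 * n + 2)) (3 * n + 2) h (guess_stage \<Gamma> d n)} \<longrightarrow> infinite {k. r k = h k})"
  proof (rule ex_generic_permutation)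
    show "perm_group (perm_span g {x. x < d})" by (rule perm_group_span[OF b])
    show "\<forall>\<gamma>\<in>perm_span g {x. x < d}. cof \<gamma>"
      using cof_perm_span_if_generic_steps[of "{x. x < d}" \<Gamma> g] IH by blast
    show "mono E"
    proof
      fix i j :: nat assume "i \<le> j"
      then show "E i \<subseteq> E j"
        using monoD[OF mono_initial_part, of i j d] by (auto simp: E_def perm_span_upto_def intro!: imageI)
    qed
    show "(\<Union>j. E j) = perm_span g {x. x < d}"
      unfolding E_def Union_perm_span_upto[OF mono_initial_part] Union_initial_part ..
    show "finite (E j)" for j
      unfolding E_def by (rule finite_perm_span_upto[OF finite_initial_part[OF assms]])
    show "pinv \<gamma> \<in> E j" if "\<gamma> \<in> E j" for j \<gamma>
      using that unfolding E_def by (intro pinv_perm_span_upto) (use b in \<open>auto dest: initial_part_less\<close>)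
  qed
  then obtain r where r: "bij r" "r \<notin> perm_span g {x. x < d}"
    "\<forall>ws. \<forall>\<gamma>\<in>perm_span g {x. x < d}. fst ` set ws \<subseteq> perm_span g {x. x < d} \<longrightarrow> cof (word_eval r ws \<circ> \<gamma>)"
    "\<forall>h. infinite {n. good_guess (E (3 * n + 2)) (3 * n + 2) h (guess_stage \<Gamma> d n)} \<longrightarrow> infinite {k. r k = h k}"
    by blast
  have "\<forall>k\<in>perm_span (g(d := r)) (insert d {x. x < d}). cof k"
    using cof_span_insert[OF b _ r(3)] by blast
  then show "\<exists>r. generic_step \<Gamma> g d r"
    using r(1,2,4) unfolding generic_step_def E_def by blast
qed

section \<open>Maximality of the generated group from a correct guess, and its cardinality\<close>

theorem mainTheorem16:
  assumes "is_omega1_type TYPE('w::wellorder)"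
    and "diamond_NN TYPE('w)"
  shows "ag_equals (UNIV :: 'w set)"
proof -
  note omega1 = assms(1)
  have inf: "infinite (UNIV :: 'w set)"
    using omega1 by (auto simp: is_omega1_type_def dest: uncountable_infinite)
  obtain \<iota> :: "'w list \<times> nat \<times> nat \<Rightarrow> 'w" where \<iota>: "inj \<iota>"
    using ex_inj_lists[OF inf] by blast
  \<comment> \<open>\<open>F\<close> searches \<open>s\<close> for the number filed under a finite
    set of letters and a stage; sorting makes the code of the set canonical. No generator is
    mentioned, so \<open>\<Gamma>\<close> can be fixed before \<open>g\<close> is built.\<close>
  define F where "F d s n = (LEAST m. \<iota> (sorted_list_of_set (initial_part d (3 * n + 2)), 3 * n + 2, m) < d \<and>
      s (\<iota> (sorted_list_of_set (initial_part d (3 * n + 2)), 3 * n + 2, m)))" for d s n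
  have "borel_F F"
    unfolding F_def by (rule borel_F_Least_coordinate)
  then obtain \<Gamma> :: "'w \<Rightarrow> nat \<Rightarrow> nat" where
    \<Gamma>: "\<And>f. stationary {d. inf_eq (F d (restrict f {x. x < d})) (\<Gamma> d)}"
    using assms(2) unfolding diamond_NN_def by blast
  obtain g where g: "\<And>d. generic_step \<Gamma> g d (g d)"
    using ex_generic_family[OF omega1] by blast
  define G where "G = perm_span g UNIV"
  have bij_g: "bij (g d)" for d using g by (simp add: generic_step_def)
  have G: "perm_group G" unfolding G_def by (rule perm_group_span) (simp add: bij_g)
  have cofG: "cof k" if "k \<in> G" for k
    using cof_perm_span_if_generic_steps[of UNIV \<Gamma> g k] g that by (simp add: G_def)
  have g_in: "g d \<in> G" for d unfolding G_def by (rule generator_in_span) simp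
  have "inj g"
  proof (rule linorder_injI)
    fix x y :: 'w assume "x < y"
    then show "g x \<noteq> g y"
      using generator_in_span[of x "{x. x < y}" g] g[of y] by (auto simp: generic_step_def)
  qed
  then have "(UNIV :: 'w set) \<lesssim> G" unfolding lepoll_def using g_in by (intro exI[of _ g]) auto
  moreover have "G \<lesssim> (UNIV :: 'w set)"
  proof -
    have "inj (\<lambda>u. \<iota> (map fst u, to_nat (map snd (u :: ('w \<times> bool) list)), 0))"
      by (rule injI) (metis \<iota> from_nat_to_nat injD prod.inject zip_map_fst_snd)
    then have "(UNIV :: ('w \<times> bool) list set) \<lesssim> (UNIV :: 'w set)"
      unfolding lepoll_def by blast
    moreover have "G \<lesssim> (UNIV :: ('w \<times> bool) list set)"
      unfolding G_def perm_span_def by (rule lepoll_trans[OF image_lepoll subset_imp_lepoll]) simp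
    ultimately show ?thesis using lepoll_trans by blast
  qed
  ultimately have "G \<approx> (UNIV :: 'w set)"
    using lepoll_antisym by blast
  moreover have "max_cofinitary_group G"
    unfolding max_cofinitary_group_def
  proof (intro conjI notI)
    show "cofinitary_group G" using G cofG by (simp add: cofinitary_group_iff)
    assume "\<exists>H. cofinitary_group H \<and> G \<subset> H"
    then obtain H h where H: "perm_group H" "\<forall>k\<in>H. cof k" "G \<subseteq> H" and h: "h \<in> H" "h \<notin> G"
      by (auto simp: cofinitary_group_iff)
    have bij_h: "bij h" using perm_groupD(1)[OF H(1) h(1)] .
    have fin_fix: "finite {x. (\<gamma> \<circ> h) x = x}" if "\<gamma> \<in> G" for \<gamma>
    proof -
      have "\<gamma> \<circ> h \<noteq> id"
      proof
        assume "\<gamma> \<circ> h = id"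
        then have "\<gamma> (h x) = x" for x by (metis comp_apply id_apply)
        then have "h = pinv \<gamma>"
          using perm_groupD(1)[OF G that] by (metis ext pinv_apply(1))
        then show False using h(2) perm_groupD(4)[OF G that] by simp
      qed
      moreover have "cof (\<gamma> \<circ> h)"
        using H(2) perm_groupD(3)[OF H(1) _ h(1)] H(3) that by blast
      ultimately show ?thesis unfolding cof_def by blast
    qed
    have ex_guess: "\<exists>xs. good_guess (perm_span_upto g a j) j h (set xs)" if "finite a" for a j
    proof -
      have "\<exists>A. good_guess (perm_span_upto g a j) j h A"
      proof (rule ex_good_guess[OF _ bij_h finite_perm_span_upto[OF that]])
        fix \<gamma> assume "\<gamma> \<in> perm_span_upto g a j"
        then have "\<gamma> \<in> G" using perm_span_upto_subset[of a UNIV g j] by (auto simp: G_def)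
        then show "bij \<gamma> \<and> cof \<gamma> \<and> finite {x. (\<gamma> \<circ> h) x = x}"
          using perm_groupD(1)[OF G] cofG fin_fix by blast
      qed simp
      then show ?thesis by (metis finite_list good_guess_def)
    qed
    \<comment> \<open>A good guess for \<open>h\<close> is filed under a finite letter set and a
      stage, without reference to any \<open>d\<close>; hence a single \<open>f\<close> serves all
      \<open>d\<close>.\<close>
    define code where "code a j = to_nat (SOME xs. good_guess (perm_span_upto g a j) j h (set xs))" for a j
    have code: "good_guess (perm_span_upto g a j) j h (set (from_nat (code a j)))" if "finite a" for a j
      unfolding code_def from_nat_to_nat by (rule someI_ex[OF ex_guess[OF that]])
    define f where "f c \<longleftrightarrow> (\<exists>a j. finite a \<and> c = \<iota> (sorted_list_of_set a, j, code a j))" for c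
    have f_iff: "f (\<iota> (sorted_list_of_set a, j, m)) \<longleftrightarrow> m = code a j" if "finite a" for a j m
      unfolding f_def using that injD[OF \<iota>] sorted_list_of_set_inject by blast
    \<comment> \<open>The stationary set of correct guesses meets the club of points closed under
      \<open>\<iota>\<close>.\<close>
    obtain d where d: "inf_eq (F d (restrict f {x. x < d})) (\<Gamma> d)"
      and closed: "\<And>xs j m. (\<forall>x\<in>set xs. x < d) \<Longrightarrow> \<iota> (xs, j, m) < d"
      using \<Gamma>[of f] club_closed_under_codes[OF omega1, of \<iota>] unfolding stationary_def by blast
    have F_eq: "F d (restrict f {x. x < d}) n = code (initial_part d (3 * n + 2)) (3 * n + 2)" for n
    proof -
      let ?a = "initial_part d (3 * n + 2)"
      have fin: "finite ?a" by (rule finite_initial_part[OF omega1])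
      \<comment> \<open>All codes consulted at \<open>d\<close> lie below \<open>d\<close>, so
        restricting \<open>f\<close> loses none of them.\<close>
      have lt: "\<iota> (sorted_list_of_set ?a, 3 * n + 2, m) < d" for m
        by (intro closed ballI) (unfold set_sorted_list_of_set[OF fin], rule initial_part_less)
      show ?thesis
        unfolding F_def using lt by (intro Least_equality) (simp_all only: f_iff[OF fin] restrict_apply mem_Collect_eq if_True simp_thms order_refl)
    qed
    have "good_guess (perm_span_upto g (initial_part d (3 * n + 2)) (3 * n + 2)) (3 * n + 2) h (guess_stage \<Gamma> d n)"
      if "F d (restrict f {x. x < d}) n = \<Gamma> d n" for n
      unfolding guess_stage_def that[symmetric] F_eq by (rule code[OF finite_initial_part[OF omega1]])
    then have "{n. F d (restrict f {x. x < d}) n = \<Gamma> d n} \<subseteq>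
      {n. good_guess (perm_span_upto g (initial_part d (3 * n + 2)) (3 * n + 2)) (3 * n + 2) h (guess_stage \<Gamma> d n)}"
      by blast
    then have "infinite {n. good_guess (perm_span_upto g (initial_part d (3 * n + 2)) (3 * n + 2)) (3 * n + 2) h (guess_stage \<Gamma> d n)}"
      using d infinite_super unfolding inf_eq_def by blast
    then have hits: "infinite {k. g d k = h k}"
      using g[of d] by (simp add: generic_step_def)
    \<comment> \<open>Points where \<open>g d\<close> and \<open>h\<close> agree are fixed by
      \<open>pinv (g d) \<circ> h\<close>, which by \<open>fin_fix\<close> has only finitely many
      fixed points.\<close>
    have "cof (pinv (g d) \<circ> h)"
      using H h(1) g_in perm_groupD(3,4)[OF H(1)] by blast
    moreover have "{k. g d k = h k} \<subseteq> {k. (pinv (g d) \<circ> h) k = k}"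
      using pinv_apply(1)[OF bij_g[of d]] by (auto simp del: pinv_apply) metis
    ultimately have "infinite {k. (pinv (g d) \<circ> h) k = k}"
      using hits infinite_super by blast
    then show False using fin_fix[OF perm_groupD(4)[OF G g_in]] by blast
  qed
  moreover have "(UNIV :: 'w set) \<lesssim> M" if "max_cofinitary_group M" for M
    using countable_cofinitary_group_not_maximal[of M] omega1_lepoll_uncountable[OF omega1, of M] that
    by (auto simp: max_cofinitary_group_def)
  ultimately show ?thesis unfolding ag_equals_def by blast
qed

end
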